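(* Let $n\ge 2$. Among all trees $T$ of order $n$ and all vertices $r\in V(T)$, the minimum value of $RC(r)$ is $n-1$, and it is attained when $T$ is a star and $r$ is its centre.
   Context: The simple random walk moves at each step to a uniformly random neighbour; $H_{vw}$ is the expected number of steps for the walk started at $v$ to first reach $w$ ($H_{vv}=0$). The reverse cover cost is $RC(r)=\sum_{w\in V(T)} H_{wr}$. *)

theory Defs
  imports "HOL-Probability.Probability" "Graph_Theory.Graph_Theory"
begin

text \<open>
  A finite simple graph is a \<^locale>\<open>pair_graph\<close>: a symmetric loop-free set of arcs.
  The constant \<^const>\<open>tree\<close> is not usable for such graphs, because it counts the closed
  walk \<open>u, v, u\<close> along the two arcs of a single edge as a cycle. The cycles of the undirected
  graph are the directed cycles of length at least 3.
\<close>

definition undirected_tree :: "'a pair_pre_digraph \<Rightarrow> bool" where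
  "undirected_tree G \<longleftrightarrow>
     pair_graph G \<and>
     Digraph_Component.connected (with_proj G) \<and>
     (\<nexists>p. pre_digraph.cycle (with_proj G) p \<and> 3 \<le> length p)"

definition star_with_centre :: "'a pair_pre_digraph \<Rightarrow> 'a \<Rightarrow> bool" where
  "star_with_centre G r \<longleftrightarrow>
     finite (pverts G) \<and> r \<in> pverts G \<and>
     parcs G = {r} \<times> (pverts G - {r}) \<union> (pverts G - {r}) \<times> {r}"

text \<open>
  Only meaningful at vertices with at least one and finitely many neighbours,
  which covers every vertex of a finite tree of order at least 2.
\<close>

definition srw_step :: "'a pair_pre_digraph \<Rightarrow> 'a \<Rightarrow> 'a pmf" where
  "srw_step G v = pmf_of_set {w. (v, w) \<in> parcs G}"

text \<open>The law of position \<open>i\<close> of the walk from \<open>v\<close>, given the positions before time \<open>i\<close>.\<close>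

definition srw_kernel :: "'a pair_pre_digraph \<Rightarrow> 'a \<Rightarrow> nat \<Rightarrow> (nat \<Rightarrow> 'a) \<Rightarrow> 'a measure" where
  "srw_kernel G v i \<omega> =
     measure_pmf (case i of 0 \<Rightarrow> return_pmf v | Suc j \<Rightarrow> srw_step G (\<omega> j))"

lemma Ionescu_Tulcea_srw: "Ionescu_Tulcea (srw_kernel G v) (\<lambda>_. count_space UNIV)"
proof (rule Ionescu_Tulcea.intro)
  fix i
  show "srw_kernel G v i \<in>
      measurable (PiM {0..<i} (\<lambda>_. count_space UNIV)) (subprob_algebra (count_space UNIV))"
  proof (cases i)
    case 0
    then show ?thesis
      by (simp add: srw_kernel_def[abs_def] measure_pmf_in_subprob_algebra)
  next
    case (Suc j)
    have "(\<lambda>\<omega>. \<omega> j) \<in> measurable (PiM {0..<i} (\<lambda>_. count_space UNIV)) (count_space UNIV)"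
      using Suc by (intro measurable_component_singleton) auto
    moreover have "(\<lambda>x. measure_pmf (srw_step G x)) \<in>
        measurable (count_space UNIV) (subprob_algebra (count_space UNIV))"
      by (simp add: measure_pmf_in_subprob_algebra)
    ultimately show ?thesis
      using Suc by (simp add: srw_kernel_def[abs_def] measurable_compose)
  qed
next
  fix i \<omega>
  show "prob_space (srw_kernel G v i \<omega>)"
    by (simp add: srw_kernel_def measure_pmf.prob_space_axioms)
qed

text \<open>The law, on trajectories, of the simple random walk on \<open>G\<close> started at \<open>v\<close>.\<close>

definition srw :: "'a pair_pre_digraph \<Rightarrow> 'a \<Rightarrow> (nat \<Rightarrow> 'a) measure" where
  "srw G v =
     projective_family.lim UNIV
       (Ionescu_Tulcea.CI (srw_kernel G v) (\<lambda>_. count_space UNIV))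
       (\<lambda>_. count_space UNIV)"

lemma prob_space_srw: "prob_space (srw G v)"
proof -
  interpret Ionescu_Tulcea "srw_kernel G v" "\<lambda>_. count_space UNIV"
    by (rule Ionescu_Tulcea_srw)
  have "emeasure PF.lim (PF.emb UNIV {} {\<lambda>_. undefined}) = emeasure (CI {}) {\<lambda>_. undefined}"
    by (rule lim) (auto simp: PiM_empty)
  moreover have "emeasure (CI {}) {\<lambda>_. undefined} = 1"
    using prob_space.emeasure_space_1[OF PF.prob_space_P[of "{}"]]
    by (simp add: PF.space_P space_PiM)
  moreover have "PF.emb UNIV {} {\<lambda>_. undefined} = space PF.lim"
    by (auto simp: prod_emb_def space_PiM PF.space_lim)
  ultimately show ?thesis
    unfolding srw_def by (intro prob_spaceI) simp
qed

definition first_hit :: "'a \<Rightarrow> (nat \<Rightarrow> 'a) \<Rightarrow> enat" where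
  "first_hit w \<omega> = (INF i\<in>{i. \<omega> i = w}. enat i)"

definition hitting_time :: "'a pair_pre_digraph \<Rightarrow> 'a \<Rightarrow> 'a \<Rightarrow> ennreal" where
  "hitting_time G v w = (\<integral>\<^sup>+ \<omega>. ennreal_of_enat (first_hit w \<omega>) \<partial>srw G v)"

definition reverse_cover_cost :: "'a pair_pre_digraph \<Rightarrow> 'a \<Rightarrow> ennreal" where
  "reverse_cover_cost G r = (\<Sum>w\<in>pverts G. hitting_time G w r)"

end

theory Submission
  imports Defs
begin

text \<open>
  A walk started at \<open>w \<noteq> r\<close> needs at least one step to reach \<open>r\<close>, so each of the \<open>n - 1\<close> vertices
  other than \<open>r\<close> contributes at least 1 to the reverse cover cost. In a star with centre \<open>r\<close> the
  first step from any other vertex leads to \<open>r\<close>, so every such contribution is exactly 1.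
\<close>

section \<open>The law of the first two positions of the walk\<close>

text \<open>
  The start \<open>v\<close> is fixed on purpose: for uncountable \<^typ>\<open>'a\<close> the set of \<open>\<omega>\<close> with
  \<open>\<omega> (Suc i) \<in> set_pmf (srw_step G (\<omega> i))\<close> need not be measurable in the product space.
\<close>

lemma AE_srw_first_step:
  "AE \<omega> in srw G v. \<omega> 0 = v \<and> \<omega> 1 \<in> set_pmf (srw_step G v)"
proof -
  let ?M = "\<lambda>_ :: nat. count_space (UNIV :: 'a set)"
  let ?Q = "\<lambda>\<omega>. \<omega> 0 = v \<and> \<omega> (Suc 0) \<in> set_pmf (srw_step G v)"
  interpret Ionescu_Tulcea "srw_kernel G v" ?M
    by (rule Ionescu_Tulcea_srw)
  \<comment> \<open>\<open>?Q\<close> only concerns positions 0 and 1, so it is the cylinder over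
    \<open>X\<close>. The probability of \<open>X\<close> is found in the finite product and then
    carried over to trajectories.\<close>
  define X where "X = {\<omega> \<in> space (PiM {0..<2} ?M). ?Q \<omega>}"
  have Q_meas: "Measurable.pred (PiM {0..<n} ?M) ?Q" if "2 \<le> n" for n
  proof -
    have [measurable]: "(\<lambda>\<omega>. \<omega> i) \<in> PiM {0..<n} ?M \<rightarrow>\<^sub>M count_space UNIV" if "i < 2" for i
      using that \<open>2 \<le> n\<close> by (intro measurable_component_singleton) auto
    have "Measurable.pred (PiM {0..<n} ?M) (\<lambda>\<omega>. \<omega> 0 = v)"
      by (rule measurable_compose[where g = "\<lambda>x. x = v" and N = "count_space UNIV"]) auto
    moreover have "Measurable.pred (PiM {0..<n} ?M) (\<lambda>\<omega>. \<omega> (Suc 0) \<in> set_pmf (srw_step G v))"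
      by (rule measurable_compose[where g = "\<lambda>x. x \<in> set_pmf (srw_step G v)"
            and N = "count_space UNIV"]) auto
    ultimately show ?thesis by (intro pred_intros_logic)
  qed
  have X[measurable]: "X \<in> sets (PiM {0..<2} ?M)"
    unfolding X_def using Q_meas[of 2] by simp
  \<comment> \<open>With an empty index set this function is the only point: the history before time
    0.\<close>
  have space0: "(\<lambda>_. undefined) \<in> space (PiM {0..<0} ?M)"
    by (simp add: space_PiM)
  \<comment> \<open>\<open>eP n \<omega>'\<close> is the law of \<open>\<omega>'(n := x)\<close>
    with \<open>x\<close> drawn from the kernel, so an almost sure claim about it reduces to one
    about the new position \<open>x\<close>.\<close>
  have AE_eP: "AE \<omega> in eP n \<omega>'. R \<omega>"
    if R: "Measurable.pred (PiM {0..<Suc n} ?M) R" and \<omega>': "\<omega>' \<in> space (PiM {0..<n} ?M)"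
      and "AE x in srw_kernel G v n \<omega>'. R (\<omega>'(n := x))" for n R \<omega>'
  proof -
    have "fun_upd \<omega>' n \<in> srw_kernel G v n \<omega>' \<rightarrow>\<^sub>M PiM {0..<Suc n} ?M"
      using \<omega>' by (intro measurable_fun_upd[where J="{0..<n}"]) (auto simp: srw_kernel_def)
    then show ?thesis
      unfolding eP_def using R that(3) by (subst AE_distr_iff) (auto simp: pred_def)
  qed
  have step0: "AE \<omega> in C 0 1 (\<lambda>_. undefined). \<omega> 0 = v"
  proof -
    \<comment> \<open>\<open>C 0 1\<close> extends the point mass at the empty history by one step;
      the left unit law of bind removes the point mass.\<close>
    have "C 0 1 (\<lambda>_. undefined) = eP 0 (\<lambda>_. undefined)"
      using bind_return[OF measurable_eP[of 0] space0] by simp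
    moreover have "Measurable.pred (PiM {0..<Suc 0} ?M) (\<lambda>\<omega>. \<omega> 0 = v)"
      by (rule measurable_compose[where g = "\<lambda>x. x = v" and N = "count_space UNIV"]) auto
    then have "AE \<omega> in eP 0 (\<lambda>_. undefined). \<omega> 0 = v"
    proof (rule AE_eP[OF _ space0])
      show "AE x in srw_kernel G v 0 (\<lambda>_. undefined). ((\<lambda>_. undefined)(0 := x)) 0 = v"
        unfolding srw_kernel_def AE_measure_pmf_iff by simp
    qed
    ultimately show ?thesis by (rule ssubst)
  qed
  \<comment> \<open>The kernel at time 1 reads only \<open>\<omega>' 0\<close>; when that is
    \<open>v\<close>, it draws from \<open>srw_step G v\<close>.\<close>
  have step1: "AE \<omega> in eP 1 \<omega>'. ?Q \<omega>"
    if "\<omega>' \<in> space (PiM {0..<1} ?M)" "\<omega>' 0 = v" for \<omega>'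
  proof (rule AE_eP)
    show "AE x in srw_kernel G v 1 \<omega>'. ?Q (\<omega>'(1 := x))"
      unfolding srw_kernel_def AE_measure_pmf_iff using that by simp
  qed (use that Q_meas in auto)
  have "AE \<omega> in C 0 2 (\<lambda>_. undefined). ?Q \<omega>"
  proof -
    have "C 0 2 (\<lambda>_. undefined) = C 0 1 (\<lambda>_. undefined) \<bind> eP 1"
      by (simp add: numeral_2_eq_2)
    also have "AE \<omega> in \<dots>. ?Q \<omega>"
    proof (subst AE_bind[where B = "PiM {0..<Suc 1} ?M"])
      show "eP 1 \<in> C 0 1 (\<lambda>_. undefined) \<rightarrow>\<^sub>M subprob_algebra (PiM {0..<Suc 1} ?M)"
        unfolding measurable_cong_sets[OF sets_C[OF space0] refl] using measurable_eP[of 1] by simp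
      show "Measurable.pred (PiM {0..<Suc 1} ?M) ?Q"
        by (rule Q_meas) simp
      show "AE \<omega>' in C 0 1 (\<lambda>_. undefined). AE \<omega> in eP 1 \<omega>'. ?Q \<omega>"
        using step0 AE_space by eventually_elim (use step1 space_C[OF space0, of 1] in auto)
    qed
    finally show ?thesis .
  qed
  moreover have sets_C2: "sets (C 0 2 (\<lambda>_. undefined)) = sets (PiM {0..<2} ?M)"
    using sets_C[OF space0, of 2] by (simp only: add_0)
  moreover from sets_C2 have "space (C 0 2 (\<lambda>_. undefined)) = space (PiM {0..<2} ?M)"
    by (rule sets_eq_imp_space_eq)
  ultimately have "AE \<omega> in C 0 2 (\<lambda>_. undefined). \<omega> \<in> X"
    using AE_space[of "C 0 2 (\<lambda>_. undefined)"] by (auto simp: X_def)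
  then have "emeasure (C 0 2 (\<lambda>_. undefined)) X = 1"
    using X sets_C2 by (intro prob_space.emeasure_eq_1_AE[OF prob_space_C[OF space0]]) auto
  \<comment> \<open>The projective limit gives a cylinder the mass of its base under the marginal on
    \<open>{0..<2}\<close>, and this marginal agrees with \<open>C 0 2\<close> on
    \<open>X\<close>.\<close>
  moreover have "emeasure (srw G v) (PF.emb UNIV {0..<2} X) = emeasure (CI {0..<2}) X"
    unfolding srw_def by (rule lim) auto
  moreover have "emeasure (CI {0..<2}) X = emeasure (C 0 2 (\<lambda>_. undefined)) X"
    using X sets.sets_into_space[OF X]
    by (subst emeasure_CI[of _ 2]) (auto simp: prod_emb_id space_PiM)
  ultimately have "emeasure (srw G v) (PF.emb UNIV {0..<2} X) = 1"
    by simp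
  then have "AE \<omega> in srw G v. \<omega> \<in> PF.emb UNIV {0..<2} X"
    by (intro prob_space.AE_prob_1[OF prob_space_srw]) (simp add: measure_def)
  then show ?thesis
    by eventually_elim (auto simp: prod_emb_def X_def)
qed

section \<open>First hits and expected hitting times\<close>

lemma first_hit_le: "\<omega> i = w \<Longrightarrow> first_hit w \<omega> \<le> enat i"
  by (auto simp: first_hit_def intro: INF_lower)

text \<open>If \<open>w\<close> is never visited, the infimum is over the empty set and hence
  infinite, so the bound covers that case too.\<close>

lemma first_hit_ge_1:
  assumes "\<omega> 0 \<noteq> w"
  shows "1 \<le> first_hit w \<omega>"
  unfolding first_hit_def
proof (rule INF_greatest)
  fix i assume "i \<in> {i. \<omega> i = w}"
  with assms have "i \<noteq> 0" by (metis mem_Collect_eq)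
  then show "1 \<le> enat i" by (simp add: one_enat_def)
qed

text \<open>Total mass 1 lets almost sure bounds and values of the first hit pass unchanged to its
  expectation.\<close>

lemma nn_integral_srw_const: "(\<integral>\<^sup>+ \<omega>. c \<partial>srw G v) = c"
  by (simp add: prob_space.emeasure_space_1[OF prob_space_srw])

lemma hitting_time_ge_1:
  assumes "w \<noteq> r"
  shows "1 \<le> hitting_time G w r"
proof -
  have "AE \<omega> in srw G w. 1 \<le> ennreal_of_enat (first_hit r \<omega>)"
    using AE_srw_first_step
  proof eventually_elim
    case (elim \<omega>)
    with assms have "1 \<le> first_hit r \<omega>" by (auto intro: first_hit_ge_1)
    then show ?case
      by (metis ennreal_of_enat_1 ennreal_of_enat_le_iff)
  qed
  from nn_integral_mono_AE[OF this] show ?thesis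
    by (simp only: nn_integral_srw_const hitting_time_def)
qed

lemma hitting_time_self: "hitting_time G r r = 0"
proof -
  have "AE \<omega> in srw G r. ennreal_of_enat (first_hit r \<omega>) = 0"
    using AE_srw_first_step
  proof eventually_elim
    case (elim \<omega>)
    then have "first_hit r \<omega> \<le> 0" by (metis first_hit_le zero_enat_def)
    then show ?case by simp
  qed
  from nn_integral_cong_AE[OF this] show ?thesis
    by (simp only: nn_integral_srw_const hitting_time_def)
qed

text \<open>With a single neighbour the step law is a point mass at \<open>r\<close>, so the first
  hit is at time 1 almost surely. The leaves of a star are in this situation.\<close>

lemma hitting_time_unique_neighbour:
  assumes "w \<noteq> r" and nb: "{u. (w, u) \<in> parcs G} = {r}"
  shows "hitting_time G w r = 1"
proof -
  have "AE \<omega> in srw G w. ennreal_of_enat (first_hit r \<omega>) = 1"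
    using AE_srw_first_step
  proof eventually_elim
    case (elim \<omega>)
    then have "\<omega> 0 = w" "\<omega> 1 = r" by (auto simp: srw_step_def nb)
    with assms(1) have "first_hit r \<omega> = 1"
      by (metis antisym first_hit_ge_1 first_hit_le one_enat_def)
    then show ?case by simp
  qed
  from nn_integral_cong_AE[OF this] show ?thesis
    by (simp only: nn_integral_srw_const hitting_time_def)
qed

section \<open>The reverse cover cost: lower bound and value at the centre of a star\<close>

lemma reverse_cover_cost_ge:
  assumes "finite (pverts G)" "r \<in> pverts G"
  shows "of_nat (card (pverts G) - 1) \<le> reverse_cover_cost G r"
proof -
  have "of_nat (card (pverts G) - 1) = (\<Sum>w\<in>pverts G - {r}. 1 :: ennreal)"
    using assms by simp
  also have "\<dots> \<le> (\<Sum>w\<in>pverts G - {r}. hitting_time G w r)"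
    by (intro sum_mono hitting_time_ge_1) auto
  also have "\<dots> \<le> reverse_cover_cost G r"
    unfolding reverse_cover_cost_def using assms by (intro sum_mono2) auto
  finally show ?thesis .
qed

lemma reverse_cover_cost_star:
  assumes "star_with_centre G r"
  shows "reverse_cover_cost G r = of_nat (card (pverts G) - 1)"
proof -
  have fin: "finite (pverts G)" "r \<in> pverts G"
    using assms by (auto simp: star_with_centre_def)
  have "hitting_time G w r = 1" if "w \<in> pverts G - {r}" for w
    using that assms by (intro hitting_time_unique_neighbour) (auto simp: star_with_centre_def)
  then have "(\<Sum>w\<in>pverts G - {r}. hitting_time G w r) = of_nat (card (pverts G) - 1)"
    using fin by simp
  then show ?thesis
    unfolding reverse_cover_cost_def using fin
    by (simp add: sum.remove[OF fin] hitting_time_self)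
qed

section \<open>Stars are connected and have no cycle of length at least 3\<close>

lemma undirected_tree_star:
  assumes "star_with_centre G r"
  shows "undirected_tree G"
proof -
  have fin: "finite (pverts G)" and r: "r \<in> pverts G"
    and arcs: "parcs G = {r} \<times> (pverts G - {r}) \<union> (pverts G - {r}) \<times> {r}"
    using assms by (auto simp: star_with_centre_def)
  interpret pair_graph G
    by unfold_locales (auto simp: fin r arcs symmetric_def sym_def)
  have edge: "r \<rightarrow>\<^sup>*\<^bsub>with_proj G\<^esub> u" "u \<rightarrow>\<^sup>*\<^bsub>with_proj G\<^esub> r" if "u \<in> pverts G" for u
    using that r arcs by (cases "u = r"; auto intro!: adj_reachable_trans)+
  have "strongly_connected (with_proj G)"
    using r edge reachable_trans[of _ r] by (auto intro!: strongly_connectedI)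
  \<comment> \<open>\<open>connected\<close> is strong connectedness of the symmetric closure; the
    arcs are already symmetric, so reachability is the same there.\<close>
  then have conn: "Digraph_Component.connected (with_proj G)"
    using reachable_mk_symmetric_eq[OF pair_sym_arcs]
    by (auto simp: connected_def strongly_connected_def)
  \<comment> \<open>Three consecutive arcs suffice for a contradiction: if \<open>u = r\<close>, the
    walk is back at \<open>u\<close> after \<open>e2\<close>; otherwise \<open>fst e2\<close> and
    \<open>snd e3\<close> are both \<open>r\<close>.\<close>
  have "\<not> 3 \<le> length p" if "cycle p" for p
  proof
    assume "3 \<le> length p"
    then obtain e1 e2 e3 q where p: "p = e1 # e2 # e3 # q"
      by (auto simp: numeral_3_eq_3 Suc_le_length_iff)
    from \<open>cycle p\<close> obtain u where walk: "awalk u p u"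
      and dist: "distinct (tl (pawalk_verts u p))"
      unfolding cycle_def by auto
    \<comment> \<open>The closed walk ends in \<open>u\<close>, so \<open>u\<close> occurs from
      \<open>snd e3\<close> onwards, and distinctness separates it from \<open>snd e2\<close>. On
      the closed walk along a single edge \<open>snd e2\<close> would be \<open>u\<close>; the third
      arc rules this out.\<close>
    have "snd e2 \<noteq> u"
    proof -
      have "last (pawalk_verts (snd e3) q) = u"
        using walk p awlast_if_cas[of "snd e3" q u] by (auto simp: awalk_def)
      then have "u \<in> set (pawalk_verts (snd e3) q)"
        by (metis awalk_verts_non_Nil last_in_set)
      then show ?thesis
        using dist walk p by (auto simp: awalk_def)
    qed
    moreover have "fst e2 \<noteq> snd e3"
    proof -
      have "snd e3 \<in> set (pawalk_verts (snd e3) q)"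
        using walk p by (cases q) (auto simp: awalk_def)
      then show ?thesis
        using dist walk p by (auto simp: awalk_def)
    qed
    moreover have "(fst e = r) \<noteq> (snd e = r)" if "e \<in> parcs G" for e
      using that unfolding arcs by auto
    moreover have "e1 \<in> parcs G" "e2 \<in> parcs G" "e3 \<in> parcs G"
      "fst e1 = u" "snd e1 = fst e2" "snd e2 = fst e3"
      using walk p by (auto simp: awalk_def)
    \<comment> \<open>Every arc has exactly one end at \<open>r\<close>, so \<open>r\<close> recurs after two steps.\<close>
    ultimately show False by metis
  qed
  with conn pair_graph_axioms show ?thesis
    unfolding undirected_tree_def by blast
qed

text \<open>Attainment is witnessed over \<open>nat\<close> because the type \<open>'a\<close> may
  have fewer than \<open>n\<close> elements, which would make the first two conjuncts
  vacuous.\<close>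

theorem theorem15:
  fixes n :: nat
  assumes "2 \<le> n"
  shows "(\<forall>(T :: 'a pair_pre_digraph) r.
            undirected_tree T \<and> card (pverts T) = n \<and> r \<in> pverts T \<longrightarrow>
            of_nat (n - 1) \<le> reverse_cover_cost T r) \<and>
         (\<forall>(T :: 'a pair_pre_digraph) r.
            star_with_centre T r \<and> card (pverts T) = n \<longrightarrow>
            undirected_tree T \<and> r \<in> pverts T \<and> reverse_cover_cost T r = of_nat (n - 1)) \<and>
         (\<exists>(T :: nat pair_pre_digraph) r.
            undirected_tree T \<and> star_with_centre T r \<and> card (pverts T) = n \<and>
            reverse_cover_cost T r = of_nat (n - 1))"
proof (intro conjI allI impI)
  fix T :: "'a pair_pre_digraph" and r
  assume "undirected_tree T \<and> card (pverts T) = n \<and> r \<in> pverts T"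
  \<comment> \<open>An infinite set has \<open>card\<close> 0, so \<open>2 \<le> n\<close> makes the
    vertex set finite.\<close>
  then show "of_nat (n - 1) \<le> reverse_cover_cost T r"
    using reverse_cover_cost_ge[of T r] assms card_ge_0_finite[of "pverts T"] by auto
next
  fix T :: "'a pair_pre_digraph" and r
  assume *: "star_with_centre T r \<and> card (pverts T) = n"
  then show "undirected_tree T" "reverse_cover_cost T r = of_nat (n - 1)"
    by (auto simp: undirected_tree_star reverse_cover_cost_star)
  from * show "r \<in> pverts T"
    by (simp add: star_with_centre_def)
next
  define T :: "nat pair_pre_digraph" where
    "T = \<lparr>pverts = {..<n}, parcs = {0} \<times> ({..<n} - {0}) \<union> ({..<n} - {0}) \<times> {0}\<rparr>"
  have "star_with_centre T 0" "card (pverts T) = n"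
    using assms by (auto simp: T_def star_with_centre_def)
  then show "\<exists>(T :: nat pair_pre_digraph) r.
      undirected_tree T \<and> star_with_centre T r \<and> card (pverts T) = n \<and>
      reverse_cover_cost T r = of_nat (n - 1)"
    by (intro exI[of _ T] exI[of _ 0]) (auto simp: undirected_tree_star reverse_cover_cost_star)
qed

end
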